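(* Let $p$ be an odd prime number. (1) Assume that $p\equiv 3\pmod 4$. Then for every integer $l$ with $0\le l<p$ we have $g_{\frac{p-1}{2},l}(p)\in\mathbb{Z}_{(p)}$. (2) Assume that $p\equiv 1\pmod 4$. Then for every odd integer $l$ with $0\le l<p$ we have $g_{\frac{p-1}{2},l}(p)\in\mathbb{Z}_{(p)}$. Furthermore, if $p\ge 13$, there exists a unique decomposition $$\{0,2,4,\dots,p-1\}=I_p^{\mathrm L}\sqcup J_p\sqcup I_p^{\mathrm R}$$ such that, for some even integers $l_{\mathrm L}$ and $l_{\mathrm R}$ with $2\le l_{\mathrm L}<l_{\mathrm R}\le p-1$, one has $$I_p^{\mathrm L}=\{l\in 2\mathbb{Z}\mid 0\le l<l_{\mathrm L}\},\quad J_p=\{l\in 2\mathbb{Z}\mid l_{\mathrm L}\le l<l_{\mathrm R}\},\quad I_p^{\mathrm R}=\{l\in 2\mathbb{Z}\mid l_{\mathrm R}\le l\le p-1\},$$ and such that for every even integer $l$ with $0\le l<p$, $$g_{\frac{p-1}{2},l}(p)\in\mathbb{Z}_{(p)}\quad\text{if and only if}\quad l\in I_p^{\mathrm L}\sqcup I_p^{\mathrm R}.$$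
   Context: For integers $k\ge 1$ and $l\ge 0$, the $(k,l)$-Göbel sequence $(g_{k,l}(n))_{n\ge 1}$ is the sequence of rational numbers defined by $$g_{k,l}(n)=\frac1n\Bigl(l+\sum_{i=1}^{n-1}g_{k,l}(i)^k\Bigr)\qquad(n\ge 1),$$ so that $g_{k,l}(1)=l$; equivalently $(n+1)g_{k,l}(n+1)=g_{k,l}(n)\bigl(n+g_{k,l}(n)^{k-1}\bigr)$. For a prime $p$, $\mathbb{Z}_{(p)}\subset\mathbb{Q}$ denotes the localization of $\mathbb{Z}$ at the prime ideal $(p)$. *)

theory Defs
  imports Complex_Main "HOL-Computational_Algebra.Primes"
begin

text \<open>The value at the unused index \<open>n = 0\<close> is \<open>l / 0 = 0\<close>; it never enters the sum.\<close>

function goebel :: "nat \<Rightarrow> nat \<Rightarrow> nat \<Rightarrow> rat" where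
  "goebel k l n = (of_nat l + (\<Sum>i\<in>{1..<n}. goebel k l i ^ k)) / of_nat n"
  by pat_completeness auto
termination
  by (relation "Wellfounded.measure (\<lambda>(k, l, n). n)") auto

declare goebel.simps [simp del]

lemma goebel_1: "goebel k l 1 = of_nat l"
  by (subst goebel.simps) simp

lemma goebel_recurrence:
  assumes "k \<ge> 1" and "n \<ge> 1"
  shows "of_nat (n + 1) * goebel k l (n + 1) = goebel k l n * (of_nat n + goebel k l n ^ (k - 1))"
proof -
  have 1: "of_nat (n + 1) * goebel k l (n + 1) = of_nat l + (\<Sum>i\<in>{1..<n + 1}. goebel k l i ^ k)"
    by (subst goebel.simps) (simp del: of_nat_add of_nat_Suc)
  have 2: "of_nat n * goebel k l n = of_nat l + (\<Sum>i\<in>{1..<n}. goebel k l i ^ k)"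
    using assms by (subst goebel.simps) simp
  have 3: "{1..<n + 1} = insert n {1..<n}"
    using assms by auto
  have 4: "goebel k l n ^ k = goebel k l n * goebel k l n ^ (k - 1)"
    using assms by (metis Suc_diff_1 less_eq_Suc_le One_nat_def power_Suc)
  have "of_nat (n + 1) * goebel k l (n + 1) = of_nat n * goebel k l n + goebel k l n ^ k"
    unfolding 1 2 3 by simp
  then show ?thesis
    unfolding 4 by (simp add: algebra_simps)
qed

definition localization_at :: "nat \<Rightarrow> rat set" where
  "localization_at p = {of_int a / of_int b | a b :: int. \<not> int p dvd b}"

end

theory Submission
  imports Defs "HOL-Number_Theory.Number_Theory"
begin

text \<open>
  Put \<open>u n = n * g n\<close>. Euler's criterion turns the recurrence into the walk
  \<open>u (n + 1) = u n + \<chi> (u n) * \<chi> n\<close> modulo \<open>p\<close>, where \<open>\<chi>\<close> is the Legendre symbol, and \<open>g p\<close> is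
  \<open>p\<close>-integral iff this walk has been absorbed at \<open>0\<close> or \<open>p\<close> by time \<open>p\<close>. For odd \<open>l\<close> the walk cannot
  pass below the diagonal, and for \<open>p \<equiv> 3\<close> modulo \<open>4\<close> and even \<open>l\<close> it cannot pass above the
  antidiagonal, so it is absorbed.

  Let \<open>p \<equiv> 1\<close> modulo \<open>4\<close>, so that \<open>\<chi> (p - x) = \<chi> x\<close>. Walks from even starting points keep their
  order. The two boundaries that separate the positions absorbed at \<open>0\<close>, the surviving ones and those
  absorbed at \<open>p\<close>, followed from time \<open>p\<close> back to time \<open>1\<close>, are \<open>z\<close> and \<open>p - w\<close> for two walks \<open>z\<close> and
  \<open>w\<close> of the same kind, reflected at \<open>0\<close>. Let \<open>a\<close> and \<open>b\<close> be the last times at which \<open>w\<close> and \<open>z\<close> vanish.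
  If nothing survives, then \<open>z + w \<ge> p\<close> at time \<open>p\<close>, while \<open>z + w \<le> (p - a) + (p - b)\<close> because a step
  has length \<open>1\<close>. A walk and a boundary cannot cross, hence \<open>z\<close> vanishes at time \<open>p - a\<close> and \<open>a + b \<ge> p\<close>.
  So equality holds throughout and both walks are straight lines after \<open>a\<close> and \<open>b\<close>, that is,
  \<open>\<chi> m = \<chi> (m - a)\<close> and \<open>\<chi> m = - \<chi> (m - b)\<close> with \<open>a + b = p\<close>. Therefore \<open>\<chi> y\<close> is the parity sign of
  the integer part of \<open>a y / p\<close>, which contradicts the multiplicativity of \<open>\<chi>\<close> at small arguments.
\<close>

section \<open>Walks driven by signs\<close>

text \<open>The factor \<open>f 0 = 0\<close> would freeze a walk at 0, so the first branch sends it
  up to 1. Index \<open>i\<close> is time \<open>i + 1\<close>, hence the argument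
  \<open>Suc i\<close> in the step.\<close>

primrec reflected_walk :: "(int \<Rightarrow> int) \<Rightarrow> int \<Rightarrow> int \<Rightarrow> nat \<Rightarrow> int" where
  "reflected_walk f s x 0 = x"
| "reflected_walk f s x (Suc i) =
     (if reflected_walk f s x i = 0 then 1
      else reflected_walk f s x i + s * f (int (Suc i)) * f (reflected_walk f s x i))"

lemma even_diff_gap:
  fixes a b :: int
  assumes "even (a - b)" and "a \<noteq> b"
  shows "a + 2 \<le> b \<or> b + 2 \<le> a"
  using assms by presburger

lemma last_zero:
  fixes r :: "nat \<Rightarrow> int"
  assumes "r i = 0" and "i \<le> n"
  obtains k where "i \<le> k" "k \<le> n" "r k = 0" "\<And>j. k < j \<Longrightarrow> j \<le> n \<Longrightarrow> r j \<noteq> 0"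
proof -
  define k where "k = Max {j. j \<le> n \<and> r j = 0}"
  have fin: "finite {j. j \<le> n \<and> r j = 0}"
    by simp
  have "k \<in> {j. j \<le> n \<and> r j = 0}"
    unfolding k_def using fin assms by (intro Max_in) auto
  moreover have "j \<le> k" if "j \<le> n" "r j = 0" for j
    unfolding k_def using fin that by (intro Max_ge) auto
  ultimately show thesis
    using that[of k] assms by force
qed

locale sign_walk =
  fixes p :: int and f :: "int \<Rightarrow> int"
  assumes odd_p: "odd p"
    and sign: "\<And>x. 0 < x \<Longrightarrow> x < p \<Longrightarrow> f x = 1 \<or> f x = -1"
    and sign_0: "f 0 = 0" and sign_p: "f p = 0"
begin

lemma sign_square: "0 < x \<Longrightarrow> x < p \<Longrightarrow> f x * f x = 1"
  using sign by fastforce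

lemma sign_mult: "0 < x \<Longrightarrow> x < p \<Longrightarrow> 0 < y \<Longrightarrow> y < p \<Longrightarrow> f x * f y = 1 \<or> f x * f y = -1"
  using sign[of x] sign[of y] by auto

lemma reflected_walk_step:
  assumes "s = 1 \<or> s = -1" and "int (Suc i) < p"
    and "0 \<le> reflected_walk f s x i" and "reflected_walk f s x i < p"
  shows "\<bar>reflected_walk f s x (Suc i) - reflected_walk f s x i\<bar> = 1"
    and "0 \<le> reflected_walk f s x (Suc i)"
proof -
  have "f (int (Suc i)) * f (reflected_walk f s x i) = 1 \<or>
      f (int (Suc i)) * f (reflected_walk f s x i) = -1" if "reflected_walk f s x i \<noteq> 0"
    using that assms by (intro sign_mult) auto
  then show "\<bar>reflected_walk f s x (Suc i) - reflected_walk f s x i\<bar> = 1"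
    and "0 \<le> reflected_walk f s x (Suc i)"
    using assms by (auto simp: mult.assoc)
qed

text \<open>\<open>w i\<close> and \<open>z i\<close> are the positions at time \<open>i + 1\<close>.\<close>

definition w :: "nat \<Rightarrow> int" where "w = reflected_walk f 1 0"
definition z :: "nat \<Rightarrow> int" where "z = reflected_walk f (-1) 1"

lemma w_0: "w 0 = 0" and z_0: "z 0 = 1"
  by (simp_all add: w_def z_def)

lemma w_Suc: "w (Suc i) = (if w i = 0 then 1 else w i + f (int (Suc i)) * f (w i))"
  and z_Suc: "z (Suc i) = (if z i = 0 then 1 else z i - f (int (Suc i)) * f (z i))"
  by (simp_all add: w_def z_def)

lemma w_bounds: "int i < p \<Longrightarrow> 0 \<le> w i \<and> w i \<le> int i \<and> even (w i + int i)"
proof (induction i)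
  case (Suc i)
  then have IH: "0 \<le> w i" "w i \<le> int i" "even (w i + int i)"
    by auto
  have "\<bar>w (Suc i) - w i\<bar> = 1" "0 \<le> w (Suc i)"
    using reflected_walk_step[of 1 i 0] IH Suc.prems by (auto simp: w_def)
  moreover from this have "w (Suc i) = w i + 1 \<or> w (Suc i) = w i - 1"
    by linarith
  ultimately show ?case
    using IH by auto
qed (simp add: w_0)

lemma z_1: "1 < p \<Longrightarrow> z 1 = 0"
  using sign_square[of 1] by (simp add: z_0 z_Suc)

lemma z_bounds: "int i < p \<Longrightarrow> 0 \<le> z i \<and> (0 < i \<longrightarrow> z i < int i) \<and> odd (z i + int i)"
proof (induction i)
  case (Suc i)
  then have IH: "0 \<le> z i" "0 < i \<longrightarrow> z i < int i" "odd (z i + int i)"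
    by auto
  have "z i < p"
    using IH Suc.prems z_0 by (cases "i = 0") auto
  then have "\<bar>z (Suc i) - z i\<bar> = 1" "0 \<le> z (Suc i)"
    using reflected_walk_step[of "-1" i 1] IH Suc.prems by (auto simp: z_def)
  moreover from this have "z (Suc i) = z i + 1 \<or> z (Suc i) = z i - 1"
    by linarith
  moreover have "i = 0 \<Longrightarrow> z (Suc i) = 0"
    using z_1 Suc.prems by simp
  ultimately show ?case
    using IH by auto
qed (simp add: z_0)

text \<open>Recursion on \<open>n - 1\<close> starts time at 1; recursion index \<open>i\<close> is
  the step leaving time \<open>Suc i\<close>. With \<open>f\<close> the Legendre symbol and
  \<open>n \<le> p\<close>, this represents \<open>n * g n\<close> modulo \<open>p\<close>.\<close>

definition walk :: "int \<Rightarrow> nat \<Rightarrow> int" where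
  "walk l n = rec_nat l (\<lambda>i a. a + f a * f (int (Suc i))) (n - 1)"

lemma walk_1: "walk l 1 = l"
  by (simp add: walk_def)

lemma walk_Suc: "0 < n \<Longrightarrow> walk l (Suc n) = walk l n + f (walk l n) * f (int n)"
  by (cases n) (auto simp: walk_def)

lemma walk_absorbed: "0 < n \<Longrightarrow> walk l n \<in> {0, p} \<Longrightarrow> walk l (Suc n) = walk l n"
  using walk_Suc[of n l] sign_0 sign_p by auto

lemma walk_step:
  assumes "0 < n" and "int n < p" and "0 < walk l n" and "walk l n < p"
  shows "walk l (Suc n) = walk l n + 1 \<or> walk l (Suc n) = walk l n - 1"
  using sign_mult[of "walk l n" "int n"] walk_Suc[of n l] assms by auto

text \<open>On the diagonal the step is \<open>f n * f n = 1\<close>, so the walk climbs along it.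
  Above it, parity leaves a gap of at least 2, and one step shrinks the gap by at most 2. At
  \<open>n = p\<close> no room is left below \<open>p\<close>.\<close>

lemma walk_odd:
  assumes "0 < n" and "int n \<le> p" and "odd l" and "0 < l" and "l < p"
  shows "walk l n \<in> {0, p} \<or> int n \<le> walk l n \<and> walk l n < p \<and> even (walk l n - int n)"
  using assms(1,2)
proof (induction n rule: nat_induct_non_zero)
  case 1
  then show ?case
    using assms walk_1[of l] by auto
next
  case (Suc n)
  then consider "walk l n \<in> {0, p}"
    | "int n \<le> walk l n" "walk l n < p" "even (walk l n - int n)" "walk l n \<notin> {0, p}"
    by force
  then show ?case
  proof cases
    case 1
    then show ?thesis
      using walk_absorbed Suc.hyps by auto
  next
    case 2
    have up: "walk l (Suc n) = walk l n + 1" if "walk l n = int n"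
      using that walk_Suc[of n l] sign_square[of "int n"] 2 Suc.hyps by auto
    have ge: "int n + 2 \<le> walk l n" if "walk l n \<noteq> int n"
      using that 2 even_diff_gap[of "walk l n" "int n"] by auto
    have "walk l (Suc n) = walk l n + 1 \<or> walk l (Suc n) = walk l n - 1"
      using walk_step[of n l] 2 Suc by auto
    then have "int (Suc n) \<le> walk l (Suc n)" "walk l (Suc n) \<le> p"
        "even (walk l (Suc n) - int (Suc n))"
      using up ge 2 by fastforce+
    then show ?thesis
      by auto
  qed
qed

text \<open>On the antidiagonal the step is \<open>f (p - n) * f n = -1\<close>, so the walk
  descends along it; at \<open>n = p\<close> the antidiagonal has reached 0.\<close>

lemma walk_even_antisymmetric:
  assumes "\<And>x. 0 < x \<Longrightarrow> x < p \<Longrightarrow> f (p - x) = - f x"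
    and "0 < n" and "int n \<le> p" and "even l" and "0 \<le> l" and "l < p"
  shows "walk l n \<in> {0, p} \<or> 0 < walk l n \<and> walk l n \<le> p - int n \<and> odd (walk l n + int n)"
  using assms(2,3)
proof (induction n rule: nat_induct_non_zero)
  case 1
  then show ?case
    using assms odd_p walk_1[of l] by auto
next
  case (Suc n)
  then consider "walk l n \<in> {0, p}"
    | "0 < walk l n" "walk l n \<le> p - int n" "odd (walk l n + int n)" "walk l n \<notin> {0, p}"
    by force
  then show ?case
  proof cases
    case 1
    then show ?thesis
      using walk_absorbed Suc.hyps by auto
  next
    case 2
    have down: "walk l (Suc n) = walk l n - 1" if "walk l n = p - int n"
      using that walk_Suc[of n l] sign_square[of "int n"] assms(1)[of "int n"] 2 Suc by auto
    have le: "walk l n \<le> p - int n - 2" if "walk l n \<noteq> p - int n"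
      using that 2 odd_p even_diff_gap[of "walk l n" "p - int n"] by fastforce
    have "walk l (Suc n) = walk l n + 1 \<or> walk l (Suc n) = walk l n - 1"
      using walk_step[of n l] 2 Suc by auto
    then have "walk l (Suc n) \<le> p - int (Suc n)" "0 \<le> walk l (Suc n)"
        "odd (walk l (Suc n) + int (Suc n))"
      using down le 2 by fastforce+
    then show ?thesis
      by auto
  qed
qed

text \<open>All steps have length 1, which gives the bound. Equality forces every step after
  \<open>k\<close> to be \<open>+1\<close>, so \<open>s * f m * f (m - k - 1) = 1\<close>. The shift
  is \<open>k + 1\<close> because index \<open>k\<close> is time \<open>k + 1\<close>.\<close>

lemma straight_after_last_zero:
  fixes s x :: int
  defines "r \<equiv> reflected_walk f s x"
  assumes s: "s = 1 \<or> s = -1" and range: "\<And>i. i \<le> n \<Longrightarrow> 0 \<le> r i \<and> r i < p" and "int n < p"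
    and last: "r k = 0" "\<And>i. k < i \<Longrightarrow> i \<le> n \<Longrightarrow> r i \<noteq> 0" and "k \<le> n"
  shows "r n \<le> int n - int k"
    and "r n = int n - int k \<Longrightarrow> int k + 1 < m \<Longrightarrow> m \<le> int n \<Longrightarrow> f m = s * f (m - int k - 1)"
proof -
  have step: "\<bar>r (Suc i) - r i\<bar> = 1" if "i < n" for i
    using reflected_walk_step(1)[OF s, of i x] that range[of i] \<open>int n < p\<close> by (simp add: r_def)
  have lip: "r j - r i \<le> int j - int i" if "i \<le> j" "j \<le> n" for i j
    using that
  proof (induction j rule: dec_induct)
    case (step j)
    then show ?case
      using \<open>\<And>i. i < n \<Longrightarrow> _\<close>[of j] by auto
  qed simp
  show "r n \<le> int n - int k"
    using lip[of k n] \<open>k \<le> n\<close> last by simp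
  assume eq: "r n = int n - int k" and m: "int k + 1 < m" "m \<le> int n"
  have straight: "r i = int i - int k" if "k \<le> i" "i \<le> n" for i
    using lip[of k i] lip[of i n] that eq last by simp
  define i where "i = nat m - 1"
  have i: "m = int (Suc i)" "k < i" "Suc i \<le> n"
    using m by (auto simp: i_def)
  have "r (Suc i) = r i + s * f m * f (r i)"
    using last(2)[of i] i by (simp add: r_def)
  then have "s * f m * f (m - int k - 1) = 1"
    using straight[of i] straight[of "Suc i"] i by simp
  moreover have "f (m - int k - 1) = 1 \<or> f (m - int k - 1) = -1"
    using sign[of "m - int k - 1"] m \<open>int n < p\<close> by auto
  ultimately show "f m = s * f (m - int k - 1)"
    using s by auto
qed

end

section \<open>Symmetric signs: boundaries of the absorbed regions\<close>

locale symmetric_sign_walk = sign_walk +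
  assumes symmetric: "\<And>x. 0 < x \<Longrightarrow> x < p \<Longrightarrow> f (p - x) = f x"
    and gt_2: "2 < p"
begin

text \<open>Here \<open>y\<close> is a boundary one time step after the position \<open>a\<close>.
  At distance at least 2, a unit move of either one cannot change the order; for
  \<open>a = y\<close> both comparisons depend on the sign of \<open>c * f y\<close> alone.\<close>

lemma step_preserves_side:
  fixes a y c :: int
  assumes "c = 1 \<or> c = -1" and "0 < a" "a < p" and "0 < y" "y < p" and "even (a - y)"
  shows "a < y - c * f y \<longleftrightarrow> a + f a * c < y"
    and "a > y - c * f y \<longleftrightarrow> a + f a * c > y"
proof -
  consider "a = y" | "a + 2 \<le> y" | "y + 2 \<le> a"
    using even_diff_gap[OF assms(6)] by blast
  then show "a < y - c * f y \<longleftrightarrow> a + f a * c < y"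
    and "a > y - c * f y \<longleftrightarrow> a + f a * c > y"
    using assms(1) sign[of a] sign[of y] assms(2-5) by (cases; auto)+
qed

text \<open>\<open>z (Suc i)\<close> is the boundary at time \<open>n\<close> and \<open>z i\<close>
  the one at time \<open>n + 1\<close>; \<open>f (p - n) = f n\<close> identifies the step of
  \<open>z\<close> with the backward step. If \<open>z i = 0\<close>, both comparisons are false,
  which is why \<open>z\<close> is reflected to 1.\<close>

lemma z_side:
  assumes "0 < n" and "int n < p" and "0 < a" and "a < p" and "odd (a + int n)"
    and "n + i + 1 = nat p"
  shows "a < z (Suc i) \<longleftrightarrow> a + f a * f (int n) < z i"
proof -
  have i: "int i = p - int n - 1" "int (Suc i) = p - int n"
    using assms by auto
  have par: "odd (z i + int i)" "0 \<le> z i" "z i < p"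
    using z_bounds[of i] i(1) assms(1) z_0 gt_2 by (cases "i = 0"; simp)+
  have fn: "f (int n) = 1 \<or> f (int n) = -1" "f (int (Suc i)) = f (int n)"
    using sign[of "int n"] symmetric[of "int n"] i assms by auto
  show ?thesis
  proof (cases "z i = 0")
    case True
    then show ?thesis
      using sign[of a] fn assms z_Suc[of i] by auto
  next
    case False
    have "even (a - z i)"
      using par(1) assms(5) odd_p unfolding i(1) by auto
    then show ?thesis
      using step_preserves_side(1)[of "f (int n)" a "z i"] fn assms False par
      by (simp add: z_Suc)
  qed
qed

text \<open>Mirror image of \<open>z_side\<close>: \<open>f\<close> is invariant under replacing
  \<open>x\<close> by \<open>p - x\<close>, but steps change direction, hence the opposite sign
  \<open>s\<close> in \<open>w\<close>.\<close>

lemma w_side: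
  assumes "0 < n" and "int n < p" and "0 < a" and "a < p" and "odd (a + int n)"
    and "n + i + 1 = nat p"
  shows "a > p - w (Suc i) \<longleftrightarrow> a + f a * f (int n) > p - w i"
proof -
  have i: "int i = p - int n - 1" "int (Suc i) = p - int n"
    using assms by auto
  have par: "even (w i + int i)" "0 \<le> w i" "w i < p"
    using w_bounds[of i] i(1) assms(1) by simp_all
  have fn: "f (int n) = 1 \<or> f (int n) = -1" "f (int (Suc i)) = f (int n)"
    using sign[of "int n"] symmetric[of "int n"] i assms by auto
  show ?thesis
  proof (cases "w i = 0")
    case True
    then show ?thesis
      using sign[of a] fn assms w_Suc[of i] by auto
  next
    case False
    have "even (a - (p - w i))"
      using par(1) assms(5) odd_p unfolding i(1) by auto
    then show ?thesis
      using step_preserves_side(2)[of "f (int n)" a "p - w i"] symmetric[of "w i"] fn assms False par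
      by (simp add: w_Suc algebra_simps)
  qed
qed

text \<open>Index \<open>nat p - 1\<close> of a boundary belongs to time 1, so these are thresholds
  for the starting value.\<close>

definition l_lower :: int where "l_lower = z (nat p - 1)"
definition l_upper :: int where "l_upper = p - w (nat p - 1)"

text \<open>The side of a boundary on which an unabsorbed walk lies never changes, so the fate at
  time \<open>p\<close> can be read off from \<open>l\<close>.\<close>

lemma walk_even_symmetric:
  assumes "0 < n" and "int n \<le> p" and "even l" and "0 < l" and "l < p"
  shows "walk l n = 0 \<and> l < l_lower \<or> walk l n = p \<and> l > l_upper \<or>
    0 < walk l n \<and> walk l n < p \<and> odd (walk l n + int n) \<and>
    (walk l n < z (nat p - n) \<longleftrightarrow> l < l_lower) \<and>
    (walk l n > p - w (nat p - n) \<longleftrightarrow> l > l_upper)"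
  using assms(1,2)
proof (induction n rule: nat_induct_non_zero)
  case 1
  then show ?case
    using assms walk_1[of l] by (auto simp: l_lower_def l_upper_def)
next
  case (Suc n)
  then consider "walk l n = 0 \<and> l < l_lower \<or> walk l n = p \<and> l > l_upper"
    | "0 < walk l n" "walk l n < p" "odd (walk l n + int n)"
      "walk l n < z (nat p - n) \<longleftrightarrow> l < l_lower"
      "walk l n > p - w (nat p - n) \<longleftrightarrow> l > l_upper"
    by force
  then show ?case
  proof cases
    case 1
    then show ?thesis
      using walk_absorbed[of n l] Suc.hyps by auto
  next
    case 2
    define i where "i = nat p - Suc n"
    have i: "nat p - n = Suc i" "n + i + 1 = nat p" "int i = p - int n - 1"
      using Suc by (auto simp: i_def)
    have step: "walk l (Suc n) = walk l n + f (walk l n) * f (int n)"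
      using walk_Suc Suc.hyps by auto
    have L: "walk l (Suc n) < z i \<longleftrightarrow> l < l_lower" and R: "walk l (Suc n) > p - w i \<longleftrightarrow> l > l_upper"
      using z_side[of n "walk l n" i] w_side[of n "walk l n" i] 2 i Suc step by auto
    have pm: "walk l (Suc n) = walk l n + 1 \<or> walk l (Suc n) = walk l n - 1"
      using walk_step[of n l] 2 Suc by auto
    then have par: "odd (walk l (Suc n) + int (Suc n))"
      using 2 by fastforce
    have "odd (z i + int i)" "0 \<le> z i" "even (w i + int i)" "0 \<le> w i"
      using z_bounds[of i] w_bounds[of i] i Suc.hyps by auto
    \<comment> \<open>By parity \<open>z i\<close>, respectively \<open>w i\<close>, is odd when the
      walk is at 0, respectively \<open>p\<close>; so absorption occurs strictly beyond the
      boundary.\<close>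
    moreover have "0 < z i" if "walk l (Suc n) = 0"
      using calculation that par i odd_p by (cases "z i = 0") auto
    moreover have "0 < w i" if "walk l (Suc n) = p"
      using calculation that par i odd_p by (cases "w i = 0") auto
    ultimately have "walk l (Suc n) = 0 \<Longrightarrow> l < l_lower" "walk l (Suc n) = p \<Longrightarrow> l > l_upper"
      using L R by auto
    then show ?thesis
      using L R par pm 2 unfolding i_def[symmetric] by auto
  qed
qed

lemma walk_0: "0 < n \<Longrightarrow> walk 0 n = 0"
  by (induction n rule: nat_induct_non_zero) (simp_all add: walk_absorbed walk_1[unfolded One_nat_def])

lemma l_lower_bounds: "0 < l_lower" "l_lower < p - 1" "odd l_lower"
proof -
  have "int (nat p - 1) = p - 1"
    using gt_2 by auto
  then show "0 < l_lower" "l_lower < p - 1" "odd l_lower"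
    using z_bounds[of "nat p - 1"] gt_2 odd_p unfolding l_lower_def
    by (auto simp: less_le) 
qed

lemma l_upper_bounds: "0 < l_upper" "l_upper \<le> p - 2" "odd l_upper"
proof -
  have i: "int (nat p - 1) = p - 1" "int (nat p - 2) = p - 2" "nat p - 1 = Suc (nat p - 2)"
    using gt_2 by auto
  have W: "even (w (nat p - 1))" "w (nat p - 1) \<le> p - 1" "0 \<le> w (nat p - 1)"
    using w_bounds[of "nat p - 1"] i odd_p by auto
  \<comment> \<open>A last step onto 0 would start at 1 and equal \<open>f (p - 1) * f 1\<close>,
    which is 1 by symmetry.\<close>
  have "w (nat p - 1) \<noteq> 0"
  proof
    assume 0: "w (nat p - 1) = 0"
    have b: "0 \<le> w (nat p - 2)" "w (nat p - 2) \<le> p - 2" "odd (w (nat p - 2))"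
      using w_bounds[of "nat p - 2"] i odd_p by auto
    then have "0 < w (nat p - 2)"
      by (cases "w (nat p - 2) = 0") auto
    then have e: "w (nat p - 2) + f (p - 1) * f (w (nat p - 2)) = 0"
      using 0 w_Suc[of "nat p - 2"] \<open>0 < w _\<close> unfolding i(3)[symmetric] i(1) by simp
    then have "w (nat p - 2) = 1"
      using sign_mult[of "p - 1" "w (nat p - 2)"] b \<open>0 < w _\<close> gt_2 by auto
    then show False
      using e symmetric[of 1] sign_square[of 1] gt_2 by auto
  qed
  then show "0 < l_upper" "l_upper \<le> p - 2" "odd l_upper"
    using W odd_p gt_2 unfolding l_upper_def by presburger+
qed

lemma dvd_walk_iff:
  assumes "even l" and "0 \<le> l" and "l < p"
  shows "p dvd walk l (nat p) \<longleftrightarrow> l < l_lower \<or> l_upper < l"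
proof (cases "l = 0")
  case True
  then show ?thesis
    using walk_0[of "nat p"] gt_2 l_lower_bounds by auto
next
  case False
  \<comment> \<open>At time \<open>p\<close> the boundaries are \<open>z 0 = 1\<close> and
    \<open>p - w 0 = p\<close>, so a position strictly between 0 and \<open>p\<close> lies beyond
    neither.\<close>
  consider "walk l (nat p) = 0" "l < l_lower" | "walk l (nat p) = p" "l_upper < l"
    | "0 < walk l (nat p)" "walk l (nat p) < p" "\<not> l < l_lower" "\<not> l_upper < l"
    using walk_even_symmetric[of "nat p" l] False assms gt_2 z_0 w_0 by auto
  then show ?thesis
    using zdvd_not_zless[of "walk l (nat p)" p] by cases auto
qed

section \<open>Meeting boundaries force periodic and antiperiodic signs\<close>

lemma collision_periods:
  assumes "l_upper \<le> l_lower"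
  obtains a where "0 < a" "a < p"
    "\<And>m. a < m \<Longrightarrow> m < p \<Longrightarrow> f m = f (m - a)"
    "\<And>m. p - a < m \<Longrightarrow> m < p \<Longrightarrow> f m = - f (m - (p - a))"
proof -
  define N where "N = nat p - 1"
  have N: "int N = p - 1" "2 \<le> N" "nat p = Suc N"
    unfolding N_def using gt_2 by linarith+
  have wb: "0 \<le> w i \<and> w i < p" if "i \<le> N" for i
    using w_bounds[of i] that N by linarith
  have zb: "0 \<le> z i \<and> z i < p" if "i \<le> N" for i
    using z_bounds[of i] that N z_0 by (cases "i = 0") auto
  obtain u where u: "u \<le> N" "w u = 0" "\<And>j. u < j \<Longrightarrow> j \<le> N \<Longrightarrow> w j \<noteq> 0"
    using last_zero[of w 0 N, OF w_0] by blast
  obtain v where v: "v \<le> N" "z v = 0" "\<And>j. v < j \<Longrightarrow> j \<le> N \<Longrightarrow> z j \<noteq> 0"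
  proof -
    have "z 1 = 0" "1 \<le> N"
      using z_1 N gt_2 by auto
    then show ?thesis
      using last_zero[of z 1 N] that by blast
  qed
  have sum: "p \<le> w N + z N"
    using assms by (simp add: l_lower_def l_upper_def N_def)
  have "z N < int N"
    using z_bounds[of N] N by auto
  then have wN: "2 \<le> w N"
    using sum N by linarith
  then have "u < N"
    using u by (cases "u = N") auto
  \<comment> \<open>After its last zero \<open>w\<close> obeys the unreflected recurrence, so it
    cannot cross the boundary \<open>z\<close>. The induction runs backwards from \<open>N\<close>,
    where \<open>w N \<ge> 2 > z 0\<close>.\<close>
  have side: "\<not> w n < z (N - n)" if "u < n" "n \<le> N" for n
    using that(2,1)
  proof (induction n rule: inc_induct)
    case base
    then show ?case
      using wN z_0 by simp
  next
    case (step n)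
    have wn: "0 < w n" "w n < p" "w n \<noteq> 0"
      using wb[of n] u(3)[of n] step by auto
    have par: "odd (w n + int (Suc n))"
      using w_bounds[of n] step N by simp
    have "N - n = Suc (N - Suc n)"
      using step by auto
    moreover have "w (Suc n) = w n + f (w n) * f (int (Suc n))"
      using wn w_Suc[of n] by simp
    ultimately show ?case
      using z_side[of "Suc n" "w n" "N - Suc n"] step wn par N by simp
  qed
  \<comment> \<open>At index \<open>Suc u\<close> the walk \<open>w\<close> has just been reflected
    to 1, so \<open>z\<close> is 0 or 1 there, and parity excludes 1.\<close>
  have "z (N - Suc u) = 0"
  proof -
    have i: "int (N - Suc u) = p - 2 - int u"
      using \<open>u < N\<close> N by auto
    have "z (N - Suc u) \<le> 1"
      using side[of "Suc u"] u \<open>u < N\<close> by (simp add: w_Suc)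
    moreover have "odd (z (N - Suc u) + int (N - Suc u))" "0 \<le> z (N - Suc u)"
      using z_bounds[of "N - Suc u"] i by auto
    moreover have "even (int u)"
      using w_bounds[of u] u N by auto
    ultimately show ?thesis
      unfolding i using odd_p by (cases "z (N - Suc u) = 1") auto
  qed
  then have "N - Suc u \<le> v"
    using v(3)[of "N - Suc u"] by force
  then have uv: "p - 2 \<le> int u + int v"
    using N \<open>u < N\<close> by linarith
  note W = straight_after_last_zero[of 1 N 0 u, folded w_def]
  note Z = straight_after_last_zero[of "-1" N 1 v, folded z_def]
  have "w N \<le> int N - int u" "z N \<le> int N - int v"
    using W(1)[OF _ wb _ u(2) u(3) u(1)] Z(1)[OF _ zb _ v(2) v(3) v(1)] N by simp_all
  \<comment> \<open>\<open>p \<le> w N + z N \<le> 2 * N - (u + v) \<le> p\<close>, so all these are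
    equalities.\<close>
  then have eq: "w N = int N - int u" "z N = int N - int v" "int u + int v = p - 2"
    using uv sum N by linarith+
  show thesis
  proof (rule that[of "int u + 1"])
    show "f m = f (m - (int u + 1))" if "int u + 1 < m" "m < p" for m
      using W(2)[OF _ wb _ u(2) u(3) u(1) eq(1), of m] N that by (simp add: diff_diff_eq)
    show "f m = - f (m - (p - (int u + 1)))" if "p - (int u + 1) < m" "m < p" for m
    proof -
      have b: "p - (int u + 1) = int v + 1"
        using eq by simp
      show ?thesis
        using Z(2)[OF _ zb _ v(2) v(3) v(1) eq(2), of m] N that unfolding b by (simp add: diff_diff_eq)
    qed
  qed (use \<open>u < N\<close> N in auto)
qed

end

section \<open>Multiplicative signs: the boundaries cannot meet\<close>

lemma floor_step_sign:
  fixes a p :: int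
  assumes "0 < a" and "a < p"
  shows "(a * (y + 1)) div p = (a * y) div p + (if (a * y) mod p + a < p then 0 else 1)"
proof -
  have "(a * (y + 1)) div p = (p * ((a * y) div p) + ((a * y) mod p + a)) div p"
    by (metis add.assoc distrib_left mult.right_neutral mult_div_mod_eq)
  also have "\<dots> = (a * y) div p + ((a * y) mod p + a) div p"
    using assms by (intro div_mult_self4) simp
  also have "((a * y) mod p + a) div p = (if (a * y) mod p + a < p then 0 else 1)"
  proof (cases "(a * y) mod p + a < p")
    case False
    have "(a * y) mod p < p"
      using assms by simp
    then have "((a * y) mod p + a - p) div p = 0"
      using False assms by (intro div_pos_pos_trivial) linarith+
    then have "((a * y) mod p + a) div p = 1"
      using False assms by (subst div_pos_geq) auto
    then show ?thesis
      using False by simp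
  qed (use assms in simp)
  finally show ?thesis .
qed

locale quadratic_sign_walk = symmetric_sign_walk +
  assumes prime: "prime p" and nonresidue: "\<exists>x. 0 < x \<and> x < p \<and> f x = -1" and sign_mod: "\<And>x. f (x mod p) = f x"
    and sign_times: "\<And>x y. f (x * y) = f x * f y"
begin

text \<open>Let \<open>r\<close> be the residue of \<open>a * y\<close>. Adding \<open>a\<close>
  without wrapping keeps \<open>f r\<close> by periodicity, while wrapping to
  \<open>r - (p - a)\<close> negates it. As \<open>f r = f a * f y\<close>, the sign of
  \<open>y\<close> flips exactly when the quotient grows.\<close>

lemma sign_of_multiple:
  assumes a: "0 < a" "a < p"
    and periodic: "\<And>m. a < m \<Longrightarrow> m < p \<Longrightarrow> f m = f (m - a)"
    and antiperiodic: "\<And>m. p - a < m \<Longrightarrow> m < p \<Longrightarrow> f m = - f (m - (p - a))"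
    and "0 < y" and "int y < p"
  shows "f (int y) = (if even ((a * int y) div p) then 1 else -1)"
  using assms(5,6)
proof (induction y rule: nat_induct_non_zero)
  case 1
  have "f 1 * f 1 = 1"
    using sign_square[of 1] gt_2 by simp
  then have "f 1 = 1"
    using sign_times[of 1 1] by (simp only: mult_1)
  then show ?case
    using a by simp
next
  case (Suc y)
  define r where "r = (a * int y) mod p"
  have nd: "\<not> p dvd a * j" if "0 < j" "j < p" for j
    using that a prime_dvd_mult_iff[OF prime, of a j] zdvd_not_zless[of a p] zdvd_not_zless[of j p]
    by blast
  have r: "0 < r" "r < p"
    using nd[of "int y"] Suc.hyps Suc.prems gt_2 pos_mod_bound[of p "a * int y"]
      pos_mod_sign[of p "a * int y"]
    unfolding r_def dvd_eq_mod_eq_0 by linarith+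
  have fr: "f r = f a * f (int y)"
    unfolding r_def sign_mod sign_times ..
  have r_next: "(r + a) mod p = (a * int (Suc y)) mod p"
    by (simp add: r_def mod_simps algebra_simps)
  then have fr': "f ((r + a) mod p) = f a * f (int (Suc y))"
    by (simp only: sign_mod sign_times)
  have "r + a \<noteq> p"
  proof
    assume "r + a = p"
    then have "(a * int (Suc y)) mod p = 0"
      using r_next by simp
    then show False
      using nd[of "int (Suc y)"] Suc.prems unfolding mod_eq_0_iff_dvd by simp
  qed
  then have "f ((r + a) mod p) = (if r + a < p then f r else - f r)"
  proof (cases "r + a < p")
    case True
    then show ?thesis
      using periodic[of "r + a"] r a by (simp add: mod_pos_pos_trivial)
  next
    case False
    have "(r + a) mod p = (r + a - p) mod p"
      by simp
    also have "\<dots> = r - (p - a)"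
      using False r a by (subst mod_pos_pos_trivial) auto
    finally have "(r + a) mod p = r - (p - a)" .
    then show ?thesis
      using antiperiodic[of r] False \<open>r + a \<noteq> p\<close> r by auto
  qed
  moreover have "f a = 1 \<or> f a = -1"
    using sign a by auto
  ultimately have "f (int (Suc y)) = (if r + a < p then f (int y) else - f (int y))"
    using fr fr' by (auto simp del: sign_mod split: if_splits)
  moreover have "(a * int (Suc y)) div p = (a * int y) div p + (if r + a < p then 0 else 1)"
    using floor_step_sign[OF a, of "int y"] by (simp add: r_def add.commute)
  ultimately show ?case
    using Suc.IH Suc.prems by simp
qed

text \<open>The signs are the parities of the quotients of \<open>a * y\<close> by \<open>p\<close>.
  For the least nonresidue \<open>q\<close>, this contradicts multiplicativity at
  \<open>2 * q\<close> if \<open>q \<ge> 3\<close> and at 6 if \<open>q = 2\<close>.\<close>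

lemma not_periodic:
  assumes "7 \<le> p" and a: "0 < a" "a < p"
    and periodic: "\<And>m. a < m \<Longrightarrow> m < p \<Longrightarrow> f m = f (m - a)"
    and antiperiodic: "\<And>m. p - a < m \<Longrightarrow> m < p \<Longrightarrow> f m = - f (m - (p - a))"
  shows False
proof -
  have sgn: "f y = (if even ((a * y) div p) then 1 else -1)" if "0 < y" "y < p" for y
    using sign_of_multiple[OF a periodic antiperiodic, of "nat y"] that by simp
  have divI: "t div p = k" if "p * k \<le> t" "t < p * k + p" for t k
    using that by (intro int_div_pos_eq[where r = "t - p * k"]) auto
  define q where "q = (LEAST q. 0 < q \<and> int q < p \<and> f (int q) = -1)"
  obtain x where "0 < x" "x < p" "f x = -1"
    using nonresidue by blast
  then have "0 < nat x \<and> int (nat x) < p \<and> f (int (nat x)) = -1"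
    by simp
  then have q: "0 < q" "int q < p" "f (int q) = -1"
    unfolding q_def by (metis (mono_tags, lifting) LeastI)+
  have min: "f y = 1" if "0 < y" "y < int q" for y
  proof -
    have "\<not> (0 < nat y \<and> int (nat y) < p \<and> f (int (nat y)) = -1)"
      using that unfolding q_def by (intro not_less_Least) auto
    then show ?thesis
      using that q sign[of y] by auto
  qed
  have "f 1 = 1"
    using sgn[of 1] a gt_2 by simp
  then have "q \<noteq> 1"
    using q by auto
  then have "q = 2 \<or> 3 \<le> q"
    using q by linarith
  \<comment> \<open>Otherwise \<open>p - q\<close> would be a smaller nonresidue by
    symmetry.\<close>
  have "2 * int q < p"
  proof (rule ccontr)
    assume "\<not> ?thesis"
    moreover have "p \<noteq> 2 * int q"
      using odd_p by auto
    ultimately have "0 < p - int q" "p - int q < int q"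
      using q by linarith+
    then show False
      using min[of "p - int q"] symmetric[of "int q"] q by simp
  qed
  from \<open>q = 2 \<or> 3 \<le> q\<close> show False
  proof
    assume "3 \<le> q"
    \<comment> \<open>If \<open>a * y < p\<close>, the next multiple is below \<open>2 * p\<close>;
      its quotient is even because the sign is 1, hence 0.\<close>
    have small: "a * int y < p" if "y < q" for y
      using that
    proof (induction y)
      case (Suc y)
      then have "a * int (Suc y) < 2 * p"
        using a by (simp add: algebra_simps)
      moreover have "even ((a * int (Suc y)) div p)"
        using min[of "int (Suc y)"] sgn[of "int (Suc y)"] Suc.prems q by (simp split: if_splits)
      moreover have "(a * int (Suc y)) div p \<noteq> 1"
        using calculation(2) by auto
      ultimately show ?case
        using divI[of 1 "a * int (Suc y)"] by linarith
    qed (use gt_2 in simp)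
    have "a * 2 \<le> a * int (q - 1)"
      using a \<open>3 \<le> q\<close> by (intro mult_left_mono) auto
    then have "2 * a < p"
      using small[of "q - 1"] \<open>3 \<le> q\<close> by simp
    have "a * int (q - 1) = a * int q - a"
      using \<open>3 \<le> q\<close> by (simp add: of_nat_diff algebra_simps)
    then have upper: "a * int q < p + a"
      using small[of "q - 1"] \<open>3 \<le> q\<close> by simp
    have "odd ((a * int q) div p)"
      using sgn[of "int q"] q by (simp split: if_splits)
    then have lower: "p \<le> a * int q"
      using a by (cases "a * int q < p") auto
    \<comment> \<open>Doubling \<open>p \<le> a * q < p + a\<close> and using
      \<open>2 * a < p\<close> places the product between \<open>2 * p\<close> and
      \<open>3 * p\<close>.\<close>
    have "(a * (2 * int q)) div p = 2"
      using upper lower \<open>2 * a < p\<close> by (intro divI) auto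
    then have "f (2 * int q) = 1"
      using sgn[of "2 * int q"] q \<open>2 * int q < p\<close> by simp
    moreover have "f (2 * int q) = - 1"
      using sign_times[of 2 "int q"] min[of 2] \<open>3 \<le> q\<close> q by simp
    ultimately show False
      by simp
  next
    assume "q = 2"
    then have f2: "f 2 = -1"
      using q by simp
    have f4: "f 4 = 1" and f6: "f 6 = - f 3"
      using sign_times[of 2 2] sign_times[of 2 3] f2 by simp_all
    have "odd ((a * 2) div p)" "even ((a * 4) div p)"
      using sgn[of 2] sgn[of 4] f2 f4 \<open>7 \<le> p\<close> by (simp_all split: if_splits)
    moreover from this(1) have "p \<le> a * 2"
      using a by (cases "a * 2 < p") auto
    moreover have "(a * 4) div p \<noteq> 3"
      using calculation(2) by auto
    ultimately have a': "p \<le> 2 * a" "4 * a < 3 * p"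
      using divI[of 3 "a * 4"] a by linarith+
    \<comment> \<open>On either side of \<open>a / p = 2 / 3\<close> the quotients at 3 and 6 have
      equal parity (1 and 3, or 2 and 4), against \<open>f 6 = - f 3\<close>.\<close>
    show False
    proof (cases "3 * a < 2 * p")
      case True
      then have "(a * 3) div p = 1" "(a * 6) div p = 3"
        using a' by (intro divI; simp)+
      then show False
        using sgn[of 3] sgn[of 6] f6 \<open>7 \<le> p\<close> by simp
    next
      case False
      then have "(a * 3) div p = 2" "(a * 6) div p = 4"
        using a' a by (intro divI; simp)+
      then show False
        using sgn[of 3] sgn[of 6] f6 \<open>7 \<le> p\<close> by simp
    qed
  qed
qed

lemma l_lower_less_l_upper:
  assumes "7 \<le> p"
  shows "l_lower < l_upper"
proof (rule ccontr)
  assume "\<not> ?thesis"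
  then have "l_upper \<le> l_lower"
    by simp
  then show False
    using not_periodic[OF assms] by (rule collision_periods)
qed

end

section \<open>The Legendre symbol\<close>

lemma Legendre_values: "Legendre x p \<in> {-1, 0, 1}"
  by (auto simp: Legendre_def)

lemma Legendre_eq_0_iff: "Legendre x p = 0 \<longleftrightarrow> p dvd x"
  by (auto simp: Legendre_def cong_0_iff)

context
  fixes p :: nat
  assumes prime: "prime p" and gt_2: "2 < p"
begin

text \<open>By Euler's criterion the two sides are congruent, and they differ by at most 2, which is
  less than \<open>p\<close>.\<close>

lemma Legendre_eqI:
  assumes "[x ^ ((p - 1) div 2) = c] (mod int p)" and "c \<in> {-1, 0, 1}"
  shows "Legendre x (int p) = c"
proof -
  have "[Legendre x (int p) = c] (mod int p)"
    using euler_criterion[OF prime gt_2, of x] assms(1) by (rule cong_trans)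
  then have "int p dvd Legendre x (int p) - c"
    by (simp add: cong_iff_dvd_diff)
  moreover have "\<bar>Legendre x (int p)\<bar> \<le> 1" "\<bar>c\<bar> \<le> 1"
    using Legendre_values[of x "int p"] assms(2) by auto
  then have "\<bar>Legendre x (int p) - c\<bar> < \<bar>int p\<bar>"
    using gt_2 by linarith
  ultimately show ?thesis
    using dvd_imp_le_int[of "Legendre x (int p) - c" "int p"] by linarith
qed

lemmas euler = euler_criterion[OF prime gt_2, THEN cong_sym]

lemma Legendre_mult: "Legendre (x * y) (int p) = Legendre x (int p) * Legendre y (int p)"
proof (rule Legendre_eqI)
  show "[(x * y) ^ ((p - 1) div 2) = Legendre x (int p) * Legendre y (int p)] (mod int p)"
    unfolding power_mult_distrib
    by (intro cong_mult euler)
  show "Legendre x (int p) * Legendre y (int p) \<in> {-1, 0, 1}"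
    using Legendre_values[of x "int p"] Legendre_values[of y "int p"] by auto
qed

lemma Legendre_mod: "Legendre (x mod int p) (int p) = Legendre x (int p)"
proof (rule Legendre_eqI)
  have "[(x mod int p) ^ ((p - 1) div 2) = x ^ ((p - 1) div 2)] (mod int p)"
    by (intro cong_pow) simp
  then show "[(x mod int p) ^ ((p - 1) div 2) = Legendre x (int p)] (mod int p)"
    using euler[of x] by (rule cong_trans)
qed (rule Legendre_values)

lemma Legendre_minus_1: "Legendre (-1) (int p) = (-1) ^ ((p - 1) div 2)"
  by (rule Legendre_eqI) (auto simp: minus_one_power_iff split: if_split)

lemma Legendre_reflect:
  "Legendre (int p - x) (int p) = (-1) ^ ((p - 1) div 2) * Legendre x (int p)"
proof -
  have "Legendre (int p - x) (int p) = Legendre (- x) (int p)"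
  proof -
    have "(int p - x) mod int p = (- x) mod int p"
      using mod_add_self1[of "int p" "- x"] by simp
    then show ?thesis
      using Legendre_mod[of "int p - x"] Legendre_mod[of "- x"] by metis
  qed
  also have "\<dots> = Legendre (-1) (int p) * Legendre x (int p)"
    using Legendre_mult[of "-1" x] by simp
  finally show ?thesis
    unfolding Legendre_minus_1 .
qed

text \<open>Otherwise squaring would be onto, hence injective, on the nonzero residues, although
  \<open>p - 1\<close> and 1 have the same square.\<close>

lemma exists_nonresidue: "\<exists>x. 0 < x \<and> x < int p \<and> Legendre x (int p) = -1"
proof (rule ccontr)
  assume none: "\<not> ?thesis"
  define S where "S = {0<..<int p}"
  define sq where "sq y = y\<^sup>2 mod int p" for y
  have p: "prime (int p)"
    using prime by simp
  have ndvd: "\<not> int p dvd y" if "y \<in> S" for y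
    using that zdvd_not_zless by (auto simp: S_def)
  have "S \<subseteq> sq ` S"
  proof
    fix x assume x: "x \<in> S"
    then have "Legendre x (int p) = 1"
      using none ndvd[of x] Legendre_values[of x "int p"] Legendre_eq_0_iff[of x "int p"]
      by (auto simp: S_def)
    then obtain y where y: "[y\<^sup>2 = x] (mod int p)"
      by (auto simp: Legendre_def QuadRes_def split: if_splits)
    then have "sq (y mod int p) = x"
      using x by (simp add: sq_def power_mod S_def cong_def)
    moreover have "y mod int p \<in> S"
    proof -
      have "y mod int p \<noteq> 0"
        using \<open>sq (y mod int p) = x\<close> x by (auto simp: sq_def S_def)
      then show ?thesis
        using gt_2 pos_mod_sign[of "int p" y] pos_mod_bound[of "int p" y] by (auto simp: S_def less_le)
    qed
    ultimately show "x \<in> sq ` S"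
      by blast
  qed
  then have "inj_on sq S"
    using finite_surj_inj[of S sq] by (simp add: S_def)
  moreover have "sq (int p - 1) = sq 1"
  proof -
    have "(int p - 1)\<^sup>2 = 1\<^sup>2 + (int p - 2) * int p"
      by (simp add: power2_eq_square algebra_simps)
    then show ?thesis
      unfolding sq_def by (simp only: mod_mult_self1)
  qed
  moreover have "int p - 1 \<in> S" "1 \<in> S"
    using gt_2 by (simp_all add: S_def)
  ultimately have "int p - 1 = 1"
    by (rule inj_onD)
  then show False
    using gt_2 by simp
qed

section \<open>Goebel sequences modulo \<open>p\<close>\<close>

text \<open>Reaching \<open>n \<le> p\<close> only requires division by numbers below
  \<open>p\<close>, so \<open>n * g n\<close> stays \<open>p\<close>-integral; its residue is
  carried as a fraction \<open>u / v\<close> with \<open>v\<close> prime to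
  \<open>p\<close>.\<close>

lemma goebel_numerator:
  fixes A :: "nat \<Rightarrow> int"
  assumes A_1: "A 1 = int l"
    and A_Suc: "\<And>n. 0 < n \<Longrightarrow> A (Suc n) = A n + Legendre (A n) (int p) * Legendre (int n) (int p)"
    and "0 < n" and "n \<le> p"
  shows "\<exists>u v. \<not> int p dvd v \<and> [u = A n * v] (mod int p) \<and>
    of_nat n * goebel ((p - 1) div 2) l n = of_int u / of_int v"
  using assms(3,4)
proof (induction n rule: nat_induct_non_zero)
  case 1
  show ?case
    using A_1 prime by (intro exI[of _ "int l"] exI[of _ 1]) (auto simp: goebel_1[unfolded One_nat_def])
next
  case (Suc n)
  define k where "k = (p - 1) div 2"
  have p: "prime (int p)"
    using prime by simp
  have k: "1 \<le> k"
    using gt_2 by (simp add: k_def)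
  obtain u v where v: "\<not> int p dvd v" and u: "[u = A n * v] (mod int p)"
    and g: "of_nat n * goebel k l n = of_int u / of_int v"
    using Suc by (auto simp: k_def)
  have n: "\<not> int p dvd int n"
    using Suc by (auto dest: dvd_imp_le)
  \<comment> \<open>\<open>U / V\<close> is \<open>u / v + (u / (n * v)) ^ k\<close> over a common
    denominator.\<close>
  define U where "U = u * v ^ k * int n ^ k + u ^ k * v"
  define V where "V = v * v ^ k * int n ^ k"
  have "\<not> int p dvd V"
    using v n p by (auto simp: V_def prime_dvd_mult_iff dest: prime_dvd_power[OF p])
  moreover have "[U = A (Suc n) * V] (mod int p)"
  proof -
    \<comment> \<open>Inserting this square into Euler's criterion for \<open>A n\<close> produces
      the factor \<open>n ^ k\<close> of \<open>V\<close> without inverting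
      \<open>n\<close>.\<close>
    have n2: "Legendre (int n) (int p) * Legendre (int n) (int p) = 1"
    proof -
      have "Legendre (int n) (int p) \<noteq> 0"
        using n unfolding Legendre_eq_0_iff .
      then show ?thesis
        using Legendre_values[of "int n" "int p"] by auto
    qed
    have "[A n ^ k = Legendre (A n) (int p) * 1] (mod int p)"
      using euler[of "A n"] by (simp add: k_def)
    moreover have "[Legendre (A n) (int p) * (Legendre (int n) (int p) * Legendre (int n) (int p)) =
        Legendre (A n) (int p) * (Legendre (int n) (int p) * int n ^ k)] (mod int p)"
      using euler_criterion[OF prime gt_2, of "int n"]
      by (intro cong_mult cong_refl) (simp add: k_def)
    ultimately have pow: "[A n ^ k = Legendre (A n) (int p) * Legendre (int n) (int p) * int n ^ k] (mod int p)"
      unfolding n2 mult.assoc by (rule cong_trans)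
    have "[U = (A n * v) * v ^ k * int n ^ k + (A n * v) ^ k * v] (mod int p)"
      unfolding U_def using u by (intro cong_add cong_mult cong_pow cong_refl)
    also have "(A n * v) * v ^ k * int n ^ k + (A n * v) ^ k * v = A n * V + A n ^ k * (v * v ^ k)"
      by (simp add: V_def power_mult_distrib algebra_simps)
    also have "[\<dots> = A n * V + (Legendre (A n) (int p) * Legendre (int n) (int p) * int n ^ k) * (v * v ^ k)] (mod int p)"
      using pow by (intro cong_add cong_mult cong_refl)
    also have "A n * V + (Legendre (A n) (int p) * Legendre (int n) (int p) * int n ^ k) * (v * v ^ k) = A (Suc n) * V"
      using A_Suc[of n] Suc.hyps by (simp add: V_def algebra_simps)
    finally show ?thesis .
  qed
  moreover have "of_nat (Suc n) * goebel k l (Suc n) = of_int U / of_int V"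
  proof -
    have nz: "of_int v \<noteq> (0::rat)" "of_nat n \<noteq> (0::rat)"
      using v Suc.hyps by auto
    have gn: "goebel k l n = of_int u / (of_nat n * of_int v)"
      using g nz by (simp add: field_simps)
    have "of_nat (Suc n) * goebel k l (Suc n) = of_nat n * goebel k l n + goebel k l n ^ k"
    proof -
      have "goebel k l n ^ k = goebel k l n * goebel k l n ^ (k - 1)"
        using k by (cases k) auto
      then show ?thesis
        using goebel_recurrence[OF k, of n l] Suc.hyps unfolding Suc_eq_plus1
        by (simp only: distrib_left mult.commute[of _ "of_nat n"])
    qed
    also have "\<dots> = of_int u / of_int v + (of_int u / (of_nat n * of_int v)) ^ k"
      unfolding g by (simp only: gn)
    also have "\<dots> = of_int U / of_int V"
    proof -
      have add: "x / y + c / (b * a) = (x * a * b + c * y) / (y * a * b)"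
        if "y \<noteq> 0" "a \<noteq> 0" "b \<noteq> 0" for x y a b c :: rat
        using that by (simp add: field_simps)
      show ?thesis
        using add[of "of_int v" "of_int v ^ k" "of_nat n ^ k" "of_int u" "of_int u ^ k"] nz
        by (simp add: U_def V_def power_divide power_mult_distrib)
    qed
    finally show ?thesis .
  qed
  ultimately show ?case
    unfolding k_def by blast
qed

text \<open>At \<open>n = p\<close> the numerator lemma writes \<open>p * g\<close> as
  \<open>u / v\<close> with \<open>u\<close> congruent to \<open>A p * v\<close>; dividing by
  \<open>p\<close> stays integral exactly when \<open>p\<close> divides \<open>u\<close>.\<close>

lemma goebel_integral_iff:
  fixes A :: "nat \<Rightarrow> int"
  assumes "A 1 = int l"
    and "\<And>n. 0 < n \<Longrightarrow> A (Suc n) = A n + Legendre (A n) (int p) * Legendre (int n) (int p)"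
  shows "goebel ((p - 1) div 2) l p \<in> localization_at p \<longleftrightarrow> int p dvd A p"
proof -
  define g where "g = goebel ((p - 1) div 2) l p"
  obtain u v where v: "\<not> int p dvd v" and u: "[u = A p * v] (mod int p)"
    and g: "of_nat p * g = of_int u / of_int v"
    using goebel_numerator[OF assms, of p] gt_2 unfolding g_def by fastforce
  have p: "prime (int p)" "of_nat p \<noteq> (0 :: rat)"
    using prime gt_2 by auto
  have vnz: "of_int v \<noteq> (0 :: rat)"
    using v by auto
  have "g \<in> localization_at p \<longleftrightarrow> int p dvd u"
  proof
    assume "g \<in> localization_at p"
    then obtain a b :: int where ab: "g = of_int a / of_int b" "\<not> int p dvd b"
      by (auto simp: localization_at_def)
    have "of_int b \<noteq> (0 :: rat)"
      using ab by auto
    then have "(of_int (int p * a * v) :: rat) = of_int (u * b)"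
      using g ab vnz by (simp add: field_simps)
    then have "int p * a * v = u * b"
      by (simp only: of_int_eq_iff)
    then have "int p dvd u * b"
      by (metis dvd_triv_left mult.assoc)
    then show "int p dvd u"
      using p ab by (simp add: prime_dvd_mult_iff)
  next
    assume "int p dvd u"
    then obtain c where "u = int p * c" ..
    then have "g = of_int c / of_int v"
      using g p vnz by (simp add: field_simps)
    then show "g \<in> localization_at p"
      using v by (auto simp: localization_at_def)
  qed
  also have "\<dots> \<longleftrightarrow> int p dvd A p * v"
    using u cong_dvd_iff by blast
  also have "\<dots> \<longleftrightarrow> int p dvd A p"
    using p v by (simp add: prime_dvd_mult_iff)
  finally show ?thesis
    unfolding g_def .
qed

end

section \<open>Uniqueness of the decomposition\<close>

lemma ex1_decomposition:
  fixes p a b :: nat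
  assumes "even a" "even b" "2 \<le> a" "a < b" "b \<le> p - 1"
    and G: "\<And>l. l < p \<Longrightarrow> even l \<Longrightarrow> G l \<longleftrightarrow> l < a \<or> b \<le> l"
  shows "\<exists>!(I_L, J, I_R).
    {l :: nat. even l \<and> l \<le> p - 1} = I_L \<union> J \<union> I_R \<and>
    I_L \<inter> J = {} \<and> I_L \<inter> I_R = {} \<and> J \<inter> I_R = {} \<and>
    (\<exists>l_L l_R :: nat. even l_L \<and> even l_R \<and>
       2 \<le> l_L \<and> l_L < l_R \<and> l_R \<le> p - 1 \<and>
       I_L = {l. even l \<and> l < l_L} \<and>
       J = {l. even l \<and> l_L \<le> l \<and> l < l_R} \<and>
       I_R = {l. even l \<and> l_R \<le> l \<and> l \<le> p - 1}) \<and>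
    (\<forall>l<p. even l \<longrightarrow> (G l \<longleftrightarrow> l \<in> I_L \<union> I_R))"
    (is "\<exists>!(I_L, J, I_R). ?P I_L J I_R")
proof (rule ex1I)
  show "case ({l. even l \<and> l < a}, {l. even l \<and> a \<le> l \<and> l < b}, {l. even l \<and> b \<le> l \<and> l \<le> p - 1})
    of (I_L, J, I_R) \<Rightarrow> ?P I_L J I_R"
    unfolding prod.case
  proof (intro conjI)
    show "\<exists>l_L l_R. even l_L \<and> even l_R \<and> 2 \<le> l_L \<and> l_L < l_R \<and> l_R \<le> p - 1 \<and>
      {l. even l \<and> l < a} = {l. even l \<and> l < l_L} \<and>
      {l. even l \<and> a \<le> l \<and> l < b} = {l. even l \<and> l_L \<le> l \<and> l < l_R} \<and>
      {l. even l \<and> b \<le> l \<and> l \<le> p - 1} = {l. even l \<and> l_R \<le> l \<and> l \<le> p - 1}"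
      using assms(1-5) by blast
    show "\<forall>l<p. even l \<longrightarrow> (G l \<longleftrightarrow>
        l \<in> {l. even l \<and> l < a} \<union> {l. even l \<and> b \<le> l \<and> l \<le> p - 1})"
      using G by auto
  qed (use assms(3-5) in auto)
  fix T
  assume T: "case T of (I_L, J, I_R) \<Rightarrow> ?P I_L J I_R"
  obtain A B C where ABC: "T = (A, B, C)"
    by (cases T)
  obtain c d where cd: "even c" "even d" "2 \<le> c" "c < d" "d \<le> p - 1"
    and sets: "A = {l. even l \<and> l < c}" "B = {l. even l \<and> c \<le> l \<and> l < d}"
      "C = {l. even l \<and> d \<le> l \<and> l \<le> p - 1}"
    and "\<forall>l<p. even l \<longrightarrow> (G l \<longleftrightarrow> l \<in> A \<union> C)"
    using T unfolding ABC prod.case by blast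
  then have G': "l < a \<or> b \<le> l \<longleftrightarrow> l < c \<or> d \<le> l" if "l < p" "even l" for l
    using G[of l] that by auto
  \<comment> \<open>The threshold \<open>a\<close> violates \<open>G\<close>, so
    \<open>a < c\<close> is impossible, and symmetrically for \<open>c\<close>. The upper thresholds
    satisfy \<open>G\<close>, which gives \<open>d = b\<close> in the same way.\<close>
  have "c = a"
    using G'[of a] G'[of c] assms(1-5) cd by linarith
  moreover have "d = b"
    using G'[of b] G'[of d] assms(1-5) cd \<open>c = a\<close> by linarith
  ultimately show "T = ({l. even l \<and> l < a}, {l. even l \<and> a \<le> l \<and> l < b},
      {l. even l \<and> b \<le> l \<and> l \<le> p - 1})"
    unfolding ABC sets by simp
qed

section \<open>Application to the Legendre symbol\<close>

theorem theorem1p1: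
  fixes p :: nat
  assumes "prime p" and "odd p"
  shows "(p mod 4 = 3 \<longrightarrow>
            (\<forall>l<p. goebel ((p - 1) div 2) l p \<in> localization_at p)) \<and>
         (p mod 4 = 1 \<longrightarrow>
            (\<forall>l<p. odd l \<longrightarrow> goebel ((p - 1) div 2) l p \<in> localization_at p) \<and>
            (p \<ge> 13 \<longrightarrow>
              (\<exists>!(I_L, J, I_R).
                 {l :: nat. even l \<and> l \<le> p - 1} = I_L \<union> J \<union> I_R \<and>
                 I_L \<inter> J = {} \<and> I_L \<inter> I_R = {} \<and> J \<inter> I_R = {} \<and>
                 (\<exists>l_L l_R :: nat. even l_L \<and> even l_R \<and>
                    2 \<le> l_L \<and> l_L < l_R \<and> l_R \<le> p - 1 \<and>
                    I_L = {l. even l \<and> l < l_L} \<and>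
                    J = {l. even l \<and> l_L \<le> l \<and> l < l_R} \<and>
                    I_R = {l. even l \<and> l_R \<le> l \<and> l \<le> p - 1}) \<and>
                 (\<forall>l<p. even l \<longrightarrow>
                    (goebel ((p - 1) div 2) l p \<in> localization_at p
                       \<longleftrightarrow> l \<in> I_L \<union> I_R)))))"
proof -
  have gt_2: "2 < p"
    using assms prime_ge_2_nat[of p] by (cases "p = 2") auto
  define f where "f x = Legendre x (int p)" for x
  have f_values: "f x = 1 \<or> f x = -1" if "0 < x" "x < int p" for x
    using Legendre_values[of x "int p"] Legendre_eq_0_iff[of x "int p"] zdvd_not_zless[of x "int p"] that
    by (auto simp: f_def)
  have f_0: "f 0 = 0" "f (int p) = 0"
    by (simp_all add: f_def Legendre_eq_0_iff)
  interpret sign_walk "int p" f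
    by unfold_locales (use assms f_values f_0 in auto)
  have integral_iff: "goebel ((p - 1) div 2) l p \<in> localization_at p \<longleftrightarrow> int p dvd walk (int l) p" for l
  proof (rule goebel_integral_iff[OF \<open>prime p\<close> gt_2])
    show "walk (int l) 1 = int l"
      by (rule walk_1)
    show "walk (int l) (Suc n) =
        walk (int l) n + Legendre (walk (int l) n) (int p) * Legendre (int n) (int p)" if "0 < n" for n
      using walk_Suc[OF that, of "int l"]
      unfolding f_def[of "walk (int l) n"] f_def[of "int n"] .
  qed
  have odd_case: "goebel ((p - 1) div 2) l p \<in> localization_at p" if "odd l" "l < p" for l
  proof -
    have "walk (int l) p \<in> {0, int p}"
      using walk_odd[of p "int l"] that gt_2 odd_pos[of l] by (simp, linarith)
    then show ?thesis
      unfolding integral_iff by auto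
  qed
  have even_case_3: "goebel ((p - 1) div 2) l p \<in> localization_at p"
    if "p mod 4 = 3" "even l" "l < p" for l
  proof -
    have "odd ((p - 1) div 2)"
      using that(1) by presburger
    then have "f (int p - x) = - f x" for x
      by (simp add: f_def Legendre_reflect[OF \<open>prime p\<close> gt_2])
    then have "walk (int l) p \<in> {0, int p}"
      using walk_even_antisymmetric[of p "int l"] that gt_2 by (simp, linarith)
    then show ?thesis
      unfolding integral_iff by auto
  qed
  have even_case_1: "\<exists>a b. even a \<and> even b \<and> 2 \<le> a \<and> a < b \<and> b \<le> p - 1 \<and>
      (\<forall>l<p. even l \<longrightarrow>
        (goebel ((p - 1) div 2) l p \<in> localization_at p \<longleftrightarrow> l < a \<or> b \<le> l))"
    if "p mod 4 = 1" "13 \<le> p"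
  proof -
    have "even ((p - 1) div 2)"
      using that(1) by presburger
    then have symm: "f (int p - x) = f x" for x
      by (simp add: f_def Legendre_reflect[OF \<open>prime p\<close> gt_2])
    interpret quadratic_sign_walk "int p" f
    proof unfold_locales
      show "\<exists>x>0. x < int p \<and> f x = - 1"
        using exists_nonresidue[OF \<open>prime p\<close> gt_2] by (simp add: f_def)
    qed (use assms gt_2 symm Legendre_mod[OF \<open>prime p\<close> gt_2] Legendre_mult[OF \<open>prime p\<close> gt_2]
        in \<open>auto simp: f_def\<close>)
    have "l_lower < l_upper"
      using l_lower_less_l_upper that by simp
    \<comment> \<open>The boundaries are odd, so even \<open>l\<close> avoid them and adding 1
      yields the even thresholds.\<close>
    have iff: "goebel ((p - 1) div 2) l p \<in> localization_at p \<longleftrightarrow> l < nat l_lower + 1 \<or> nat l_upper + 1 \<le> l"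
      if "l < p" "even l" for l
    proof -
      have "int l \<noteq> l_lower"
        using that(2) l_lower_bounds(3) by (metis even_of_nat)
      then show ?thesis
        unfolding integral_iff using dvd_walk_iff[of "int l"] that l_lower_bounds(1) l_upper_bounds(1)
        by auto
    qed
    show ?thesis
    proof (intro exI conjI)
      show "even (nat l_lower + 1)" "even (nat l_upper + 1)"
        using l_lower_bounds l_upper_bounds by (simp_all add: even_nat_iff)
      show "2 \<le> nat l_lower + 1" "nat l_lower + 1 < nat l_upper + 1" "nat l_upper + 1 \<le> p - 1"
        using l_lower_bounds l_upper_bounds \<open>l_lower < l_upper\<close> by linarith+
      show "\<forall>l<p. even l \<longrightarrow> (goebel ((p - 1) div 2) l p \<in> localization_at p \<longleftrightarrow>
          l < nat l_lower + 1 \<or> nat l_upper + 1 \<le> l)"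
        using iff by blast
    qed
  qed
  show ?thesis
  proof (intro conjI impI)
    show "\<forall>l<p. goebel ((p - 1) div 2) l p \<in> localization_at p" if "p mod 4 = 3"
      using odd_case even_case_3 that by blast
    show "\<forall>l<p. odd l \<longrightarrow> goebel ((p - 1) div 2) l p \<in> localization_at p"
      using odd_case by blast
  next
    assume "p mod 4 = 1" "13 \<le> p"
    then obtain a b where "even a" "even b" "2 \<le> a" "a < b" "b \<le> p - 1"
      and "\<And>l. l < p \<Longrightarrow> even l \<Longrightarrow>
        goebel ((p - 1) div 2) l p \<in> localization_at p \<longleftrightarrow> l < a \<or> b \<le> l"
      using even_case_1 by blast
    then show "\<exists>!(I_L, J, I_R).
                 {l :: nat. even l \<and> l \<le> p - 1} = I_L \<union> J \<union> I_R \<and>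
                 I_L \<inter> J = {} \<and> I_L \<inter> I_R = {} \<and> J \<inter> I_R = {} \<and>
                 (\<exists>l_L l_R :: nat. even l_L \<and> even l_R \<and>
                    2 \<le> l_L \<and> l_L < l_R \<and> l_R \<le> p - 1 \<and>
                    I_L = {l. even l \<and> l < l_L} \<and>
                    J = {l. even l \<and> l_L \<le> l \<and> l < l_R} \<and>
                    I_R = {l. even l \<and> l_R \<le> l \<and> l \<le> p - 1}) \<and>
                 (\<forall>l<p. even l \<longrightarrow>
                    (goebel ((p - 1) div 2) l p \<in> localization_at p
                       \<longleftrightarrow> l \<in> I_L \<union> I_R))"
      by (rule ex1_decomposition)
  qed
qed

end
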